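(* Let $\mathcal{S}=\langle\mathcal{L},\vdash\rangle$ be an LFI with respect to $\neg$ and $\bigcirc(p)$. Then: (i) pfECQ and sECQ hold in $\mathcal{S}$. (ii) If $\mathcal{S}$ is finitely gently explosive (i.e., $\bigcirc(p)$ is finite) and the signature of $\mathcal{S}$ contains a binary conjunction operator $\land$ such that $\{\alpha\land\beta\}\vdash\alpha$ and $\{\alpha\land\beta\}\vdash\beta$ for all $\alpha,\beta\in\mathcal{L}$, then spECQ and gECQ hold in $\mathcal{S}$.
   Context: $\mathcal{L}$ is the formula algebra over a denumerable set $V$ of variables in a finite signature containing a unary operator $\neg$; $C_\vdash(\Gamma)=\{\alpha:\Gamma\vdash\alpha\}$ for $\vdash\,\subseteq\mathcal{P}(\mathcal{L})\times\mathcal{L}$. $\mathcal{S}$ is standard if it is Tarskian (reflexive: $\Gamma\subseteq C_\vdash(\Gamma)$; monotonic: $\Gamma\subseteq\Sigma\Rightarrow C_\vdash(\Gamma)\subseteq C_\vdash(\Sigma)$; transitive: $\Sigma\subseteq C_\vdash(\Gamma)\Rightarrow C_\vdash(\Sigma)\subseteq C_\vdash(\Gamma)$), structural (closed under substitutions, i.e., endomorphisms of $\mathcal{L}$), and finitary ($\Gamma\vdash\alpha$ implies $\Gamma'\vdash\alpha$ for some finite $\Gamma'\subseteq\Gamma$). Let $p\in V$ and $\bigcirc(p)$ a nonempty set of formulas whose set of variables is exactly $\{p\}$; for $\varphi\in\mathcal{L}$, $\bigcirc(\varphi)=\{\psi(\varphi):\psi(p)\in\bigcirc(p)\}$ (substituting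 $\varphi$ for $p$). A standard logic $\mathcal{S}$ is an LFI with respect to $\neg$ and $\bigcirc(p)$ if: (a) there is $\varphi$ with $C_\vdash(\{\varphi,\neg\varphi\})\neq\mathcal{L}$; (b) there are $\alpha,\beta$ with $\beta\notin C_\vdash(\bigcirc(\alpha)\cup\{\alpha\})\cup C_\vdash(\bigcirc(\alpha)\cup\{\neg\alpha\})$; (c) $C_\vdash(\bigcirc(\varphi)\cup\{\varphi,\neg\varphi\})=\mathcal{L}$ for all $\varphi\in\mathcal{L}$. Principles: pfECQ: for every $\Gamma\subsetneq\mathcal{L}$ there is $\Delta\subsetneq\mathcal{L}$ with $\Gamma\subseteq\Delta$ and $C_\vdash(\Delta)=\mathcal{L}$. sECQ: for each $\alpha$ there is $\Gamma\subsetneq\mathcal{L}$ with $\alpha\in\Gamma$ and $C_\vdash(\Gamma)=\mathcal{L}$. spECQ: for every $\Gamma\subsetneq\mathcal{L}$ there is $\alpha$ with $\Gamma\cup\{\alpha\}\subsetneq\mathcal{L}$ and $C_\vdash(\Gamma\cup\{\alpha\})=\mathcal{L}$. gECQ: for each $\alpha$ there is $\beta$ with $C_\vdash(\{\alpha,\beta\})=\mathcal{L}$. *)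

theory Defs
  imports Main "HOL-Library.Countable_Set"
begin

datatype ('c, vars: 'v) fm = Var 'v | Op 'c "('c, 'v) fm list"

primrec subst :: "('v \<Rightarrow> ('c, 'v) fm) \<Rightarrow> ('c, 'v) fm \<Rightarrow> ('c, 'v) fm" where
  "subst s (Var x) = s x"
| "subst s (Op c ts) = Op c (map (subst s) ts)"

text \<open>The carrier of the formula algebra over the connectives \<open>Sig\<close>, with arities \<open>ar\<close>,
  and the variables \<open>V\<close>. The raw datatype also contains terms that violate arities.\<close>

inductive_set formulas :: "'c set \<Rightarrow> ('c \<Rightarrow> nat) \<Rightarrow> 'v set \<Rightarrow> ('c, 'v) fm set"
  for Sig :: "'c set" and ar :: "'c \<Rightarrow> nat" and V :: "'v set" where
  Var: "x \<in> V \<Longrightarrow> Var x \<in> formulas Sig ar V"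
| Op: "c \<in> Sig \<Longrightarrow> length ts = ar c \<Longrightarrow> \<forall>t \<in> set ts. t \<in> formulas Sig ar V
    \<Longrightarrow> Op c ts \<in> formulas Sig ar V"

definition endomorphism ::
  "'c set \<Rightarrow> ('c \<Rightarrow> nat) \<Rightarrow> 'v set \<Rightarrow> (('c, 'v) fm \<Rightarrow> ('c, 'v) fm) \<Rightarrow> bool" where
  "endomorphism Sig ar V h \<longleftrightarrow>
    (\<forall>\<phi> \<in> formulas Sig ar V. h \<phi> \<in> formulas Sig ar V) \<and>
    (\<forall>c \<in> Sig. \<forall>ts. length ts = ar c \<longrightarrow> set ts \<subseteq> formulas Sig ar V
      \<longrightarrow> h (Op c ts) = Op c (map h ts))"

type_synonym 'a consequence = "('a set \<times> 'a) set"

definition Cn :: "'a consequence \<Rightarrow> 'a set \<Rightarrow> 'a set" where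
  "Cn D \<Gamma> = {\<alpha>. (\<Gamma>, \<alpha>) \<in> D}"

definition tarskian :: "'a set \<Rightarrow> 'a consequence \<Rightarrow> bool" where
  "tarskian L D \<longleftrightarrow>
    (\<forall>\<Gamma> \<subseteq> L. \<Gamma> \<subseteq> Cn D \<Gamma>) \<and>
    (\<forall>\<Gamma> \<Sigma>. \<Gamma> \<subseteq> \<Sigma> \<and> \<Sigma> \<subseteq> L \<longrightarrow> Cn D \<Gamma> \<subseteq> Cn D \<Sigma>) \<and>
    (\<forall>\<Gamma> \<Sigma>. \<Gamma> \<subseteq> L \<and> \<Sigma> \<subseteq> Cn D \<Gamma> \<longrightarrow> Cn D \<Sigma> \<subseteq> Cn D \<Gamma>)"

definition structural ::
  "'c set \<Rightarrow> ('c \<Rightarrow> nat) \<Rightarrow> 'v set \<Rightarrow> ('c, 'v) fm consequence \<Rightarrow> bool" where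
  "structural Sig ar V D \<longleftrightarrow>
    (\<forall>h \<Gamma> \<alpha>. endomorphism Sig ar V h \<and> (\<Gamma>, \<alpha>) \<in> D \<longrightarrow> (h ` \<Gamma>, h \<alpha>) \<in> D)"

definition finitary :: "'a consequence \<Rightarrow> bool" where
  "finitary D \<longleftrightarrow> (\<forall>\<Gamma> \<alpha>. (\<Gamma>, \<alpha>) \<in> D \<longrightarrow> (\<exists>\<Gamma>' \<subseteq> \<Gamma>. finite \<Gamma>' \<and> (\<Gamma>', \<alpha>) \<in> D))"

definition standard_logic ::
  "'c set \<Rightarrow> ('c \<Rightarrow> nat) \<Rightarrow> 'v set \<Rightarrow> ('c, 'v) fm consequence \<Rightarrow> bool" where
  "standard_logic Sig ar V D \<longleftrightarrow>
    D \<subseteq> Pow (formulas Sig ar V) \<times> formulas Sig ar V \<and>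
    tarskian (formulas Sig ar V) D \<and> structural Sig ar V D \<and> finitary D"

definition circ :: "'v \<Rightarrow> ('c, 'v) fm set \<Rightarrow> ('c, 'v) fm \<Rightarrow> ('c, 'v) fm set" where
  "circ p B \<phi> = subst (Var(p := \<phi>)) ` B"

text \<open>The set \<open>B\<close> plays the role of \<open>\<circle>(p)\<close>.\<close>

definition LFI :: "'c set \<Rightarrow> ('c \<Rightarrow> nat) \<Rightarrow> 'v set \<Rightarrow> ('c, 'v) fm consequence
    \<Rightarrow> 'c \<Rightarrow> 'v \<Rightarrow> ('c, 'v) fm set \<Rightarrow> bool" where
  "LFI Sig ar V D neg p B \<longleftrightarrow>
    standard_logic Sig ar V D \<and>
    (\<exists>\<phi> \<in> formulas Sig ar V. Cn D {\<phi>, Op neg [\<phi>]} \<noteq> formulas Sig ar V) \<and>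
    (\<exists>\<alpha> \<in> formulas Sig ar V. \<exists>\<beta> \<in> formulas Sig ar V.
      \<beta> \<notin> Cn D (circ p B \<alpha> \<union> {\<alpha>}) \<union> Cn D (circ p B \<alpha> \<union> {Op neg [\<alpha>]})) \<and>
    (\<forall>\<phi> \<in> formulas Sig ar V. Cn D (circ p B \<phi> \<union> {\<phi>, Op neg [\<phi>]}) = formulas Sig ar V)"

definition pfECQ :: "'a set \<Rightarrow> 'a consequence \<Rightarrow> bool" where
  "pfECQ L D \<longleftrightarrow> (\<forall>\<Gamma> \<subset> L. \<exists>\<Delta> \<subset> L. \<Gamma> \<subseteq> \<Delta> \<and> Cn D \<Delta> = L)"

definition sECQ :: "'a set \<Rightarrow> 'a consequence \<Rightarrow> bool" where
  "sECQ L D \<longleftrightarrow> (\<forall>\<alpha> \<in> L. \<exists>\<Gamma> \<subset> L. \<alpha> \<in> \<Gamma> \<and> Cn D \<Gamma> = L)"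

definition spECQ :: "'a set \<Rightarrow> 'a consequence \<Rightarrow> bool" where
  "spECQ L D \<longleftrightarrow> (\<forall>\<Gamma> \<subset> L. \<exists>\<alpha> \<in> L. \<Gamma> \<union> {\<alpha>} \<subset> L \<and> Cn D (\<Gamma> \<union> {\<alpha>}) = L)"

definition gECQ :: "'a set \<Rightarrow> 'a consequence \<Rightarrow> bool" where
  "gECQ L D \<longleftrightarrow> (\<forall>\<alpha> \<in> L. \<exists>\<beta> \<in> L. Cn D {\<alpha>, \<beta>} = L)"

end

theory Submission imports Defs begin

text \<open>Substituting \<open>\<phi>\<close> for \<open>p\<close> in a formula that contains \<open>p\<close> yields a formula at least as large
  as \<open>\<phi>\<close>. Taking \<open>\<phi>\<close> of large size therefore gives explosive sets
  \<open>\<circle>(\<phi>) \<union> {\<phi>, \<not>\<phi>}\<close> all of whose members are larger than a prescribed formula \<open>\<gamma>\<close>. If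
  \<open>\<gamma> \<notin> \<Gamma>\<close>, such a set can be added to \<open>\<Gamma>\<close> without capturing \<open>\<gamma>\<close>. When \<open>\<circle>(p)\<close> is finite
  and a conjunction is available, the explosive set can be replaced by one formula, the iterated
  conjunction of its members, which is larger still.\<close>

text \<open>An occurrence of \<open>x\<close> in \<open>t\<close> becomes a copy of
  \<open>s x\<close> inside \<open>subst s t\<close>, and a subterm is never larger than the
  whole.\<close>

lemma size_le_size_subst:
  "x \<in> vars t \<Longrightarrow> size (s x) \<le> size (subst s t)"
proof (induction t)
  case (Var y)
  then show ?case by simp
next
  case (Op c ts)
  then obtain t where t: "t \<in> set ts" "x \<in> vars t" by auto
  then have "size (s x) \<le> size (subst s t)" using Op.IH by blast
  also have "\<dots> \<le> size_list size (map (subst s) ts)"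
    using t(1) by (intro size_list_estimation'[where x = "subst s t"]) auto
  finally show ?case by simp
qed

lemma subst_in_formulas:
  assumes "t \<in> formulas Sig ar V" and "\<And>x. x \<in> V \<Longrightarrow> s x \<in> formulas Sig ar V"
  shows "subst s t \<in> formulas Sig ar V"
  using assms(1) by induction (auto intro!: formulas.Op assms(2))

lemma circ_subset_formulas:
  assumes "B \<subseteq> formulas Sig ar V" and "\<phi> \<in> formulas Sig ar V"
  shows "circ p B \<phi> \<subseteq> formulas Sig ar V"
  using assms by (auto simp: circ_def intro!: subst_in_formulas formulas.Var)

lemma size_le_size_circ:
  assumes "\<forall>\<psi> \<in> B. vars \<psi> = {p}" and "\<chi> \<in> circ p B \<phi>"
  shows "size \<phi> \<le> size \<chi>"
proof -
  obtain \<psi> where "\<psi> \<in> B" "\<chi> = subst (Var(p := \<phi>)) \<psi>" using assms(2) by (auto simp: circ_def)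
  then show ?thesis using assms(1) size_le_size_subst[of p \<psi> "Var(p := \<phi>)"] by simp
qed

lemma unary_in_formulas:
  assumes "c \<in> Sig" and "ar c = 1" and "\<phi> \<in> formulas Sig ar V"
  shows "Op c [\<phi>] \<in> formulas Sig ar V"
  using assms by (intro formulas.Op) simp_all

lemma binary_in_formulas:
  assumes "c \<in> Sig" and "ar c = 2" and "\<phi> \<in> formulas Sig ar V" and "\<psi> \<in> formulas Sig ar V"
  shows "Op c [\<phi>, \<psi>] \<in> formulas Sig ar V"
  using assms by (intro formulas.Op) simp_all

text \<open>Negations stacked on a variable suffice, since each one strictly increases the
  size.\<close>

lemma exists_large_formula:
  assumes "neg \<in> Sig" and "ar neg = 1" and "V \<noteq> {}"
  shows "\<exists>\<phi> \<in> formulas Sig ar V. n < size \<phi>"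
proof (induction n)
  case 0
  obtain x where "x \<in> V" using assms(3) by blast
  then have "Op neg [Var x] \<in> formulas Sig ar V"
    by (intro unary_in_formulas assms formulas.Var)
  then show ?case by (rule bexI[rotated]) simp
next
  case (Suc n)
  then obtain \<phi> where "\<phi> \<in> formulas Sig ar V" "n < size \<phi>" by blast
  then show ?case using unary_in_formulas[where ar = ar, OF assms(1,2)]
    by (intro bexI[where x = "Op neg [\<phi>]"]) auto
qed

lemma Cn_subset:
  assumes "standard_logic Sig ar V D"
  shows "Cn D \<Gamma> \<subseteq> formulas Sig ar V"
  using assms by (auto simp: standard_logic_def Cn_def)

lemma Cn_refl:
  assumes "standard_logic Sig ar V D" and "\<Gamma> \<subseteq> formulas Sig ar V"
  shows "\<Gamma> \<subseteq> Cn D \<Gamma>"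
  using assms unfolding standard_logic_def tarskian_def by simp

lemma Cn_mono:
  assumes "standard_logic Sig ar V D" and "\<Gamma> \<subseteq> \<Sigma>" and "\<Sigma> \<subseteq> formulas Sig ar V"
  shows "Cn D \<Gamma> \<subseteq> Cn D \<Sigma>"
  using assms unfolding standard_logic_def tarskian_def by simp

lemma Cn_trans:
  assumes "standard_logic Sig ar V D" and "\<Gamma> \<subseteq> formulas Sig ar V" and "\<Sigma> \<subseteq> Cn D \<Gamma>"
  shows "Cn D \<Sigma> \<subseteq> Cn D \<Gamma>"
  using assms unfolding standard_logic_def tarskian_def by simp

text \<open>Serves twice: for enlarging an explosive set by further formulas, and for replacing its
  members by one formula that entails them all.\<close>

lemma explosive_if_proves_explosive:
  assumes "standard_logic Sig ar V D" and "\<Gamma> \<subseteq> formulas Sig ar V"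
    and "\<Sigma> \<subseteq> Cn D \<Gamma>" and "Cn D \<Sigma> = formulas Sig ar V"
  shows "Cn D \<Gamma> = formulas Sig ar V"
  using Cn_trans[OF assms(1-3)] Cn_subset[OF assms(1)] assms(4) by blast

text \<open>Gentle explosion is instantiated at one large \<phi>. Nonemptiness and finiteness are
  recorded so that an iterated conjunction of \<open>E\<close> can be formed.\<close>

lemma exists_large_explosive_set:
  assumes "neg \<in> Sig" and "ar neg = 1" and "V \<noteq> {}"
    and "B \<subseteq> formulas Sig ar V" and "\<forall>\<psi> \<in> B. vars \<psi> = {p}"
    and "LFI Sig ar V D neg p B"
  shows "\<exists>E \<subseteq> formulas Sig ar V. E \<noteq> {} \<and> (finite B \<longrightarrow> finite E) \<and>
    Cn D E = formulas Sig ar V \<and> (\<forall>\<chi> \<in> E. n < size \<chi>)"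
proof -
  obtain \<phi> where \<phi>: "\<phi> \<in> formulas Sig ar V" "n < size \<phi>"
    using exists_large_formula[where ar = ar, OF assms(1-3)] by blast
  let ?E = "circ p B \<phi> \<union> {\<phi>, Op neg [\<phi>]}"
  have "?E \<subseteq> formulas Sig ar V"
    using circ_subset_formulas[OF assms(4) \<phi>(1)] \<phi>(1)
      unary_in_formulas[where ar = ar, OF assms(1,2) \<phi>(1)]
    by blast
  moreover have "finite B \<longrightarrow> finite ?E" by (simp add: circ_def)
  moreover have "Cn D ?E = formulas Sig ar V" using assms(6) \<phi>(1) by (simp add: LFI_def)
  moreover have "\<forall>\<chi> \<in> ?E. n < size \<chi>"
    using \<phi>(2) size_le_size_circ[OF assms(5)] by (auto intro: less_le_trans)
  ultimately show ?thesis by (intro exI[where x = ?E]) blast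
qed

text \<open>The witness is the iterated conjunction, built by induction on \<open>E\<close>. The
  size bound later separates it from a given small formula.\<close>

lemma exists_finite_conjunction:
  assumes std: "standard_logic Sig ar V D" and con: "con \<in> Sig" "ar con = 2"
    and elim: "\<forall>\<alpha> \<in> formulas Sig ar V. \<forall>\<beta> \<in> formulas Sig ar V.
      ({Op con [\<alpha>, \<beta>]}, \<alpha>) \<in> D \<and> ({Op con [\<alpha>, \<beta>]}, \<beta>) \<in> D"
    and E: "finite E" "E \<noteq> {}" "E \<subseteq> formulas Sig ar V"
  shows "\<exists>\<beta> \<in> formulas Sig ar V. E \<subseteq> Cn D {\<beta>} \<and> (\<forall>\<chi> \<in> E. size \<chi> \<le> size \<beta>)"
  using E
proof (induction rule: finite_ne_induct)
  case (singleton x)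
  then show ?case using Cn_refl[OF std, of "{x}"] by auto
next
  case (insert x F)
  then obtain \<beta> where \<beta>: "\<beta> \<in> formulas Sig ar V" "F \<subseteq> Cn D {\<beta>}" "\<forall>\<chi> \<in> F. size \<chi> \<le> size \<beta>"
    by auto
  let ?\<gamma> = "Op con [x, \<beta>]"
  have x: "x \<in> formulas Sig ar V" using insert.prems by simp
  have \<gamma>: "?\<gamma> \<in> formulas Sig ar V" using binary_in_formulas[where ar = ar, OF con x \<beta>(1)] .
  have "x \<in> Cn D {?\<gamma>}" "{\<beta>} \<subseteq> Cn D {?\<gamma>}" using elim x \<beta>(1) by (auto simp: Cn_def)
  \<comment> \<open>By transitivity, what the old conjunction \<beta> yields, in particular
    \<open>F\<close>, is still yielded by the new one.\<close>
  moreover have "Cn D {\<beta>} \<subseteq> Cn D {?\<gamma>}" using Cn_trans[OF std] \<gamma> calculation(2) by simp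
  ultimately have "insert x F \<subseteq> Cn D {?\<gamma>}" using \<beta>(2) by blast
  then show ?case using \<gamma> \<beta>(3) by (intro bexI[where x = ?\<gamma>]) auto
qed

text \<open>Since \<open>L\<close> is no singleton, {\<alpha>} is a proper subset of
  \<open>L\<close> and can play the role of \<Gamma>.\<close>

lemma pfECQ_imp_sECQ:
  assumes "pfECQ L D" and "\<And>\<alpha>. L \<noteq> {\<alpha>}"
  shows "sECQ L D"
  unfolding sECQ_def
proof
  fix \<alpha> assume "\<alpha> \<in> L"
  then have "{\<alpha>} \<subset> L" using assms(2) by blast
  then obtain \<Delta> where "\<Delta> \<subset> L" "{\<alpha>} \<subseteq> \<Delta>" "Cn D \<Delta> = L"
    using assms(1)[unfolded pfECQ_def, rule_format, of "{\<alpha>}"] by blast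
  then show "\<exists>\<Gamma> \<subset> L. \<alpha> \<in> \<Gamma> \<and> Cn D \<Gamma> = L" by blast
qed

lemma spECQ_imp_gECQ:
  assumes "spECQ L D" and "\<And>\<alpha>. L \<noteq> {\<alpha>}"
  shows "gECQ L D"
  unfolding gECQ_def
proof
  fix \<alpha> assume "\<alpha> \<in> L"
  then have "{\<alpha>} \<subset> L" using assms(2) by blast
  then obtain \<beta> where "\<beta> \<in> L" "Cn D ({\<alpha>} \<union> {\<beta>}) = L"
    using assms(1)[unfolded spECQ_def, rule_format, of "{\<alpha>}"] by blast
  then show "\<exists>\<beta> \<in> L. Cn D {\<alpha>, \<beta>} = L" by (auto simp: insert_commute)
qed

theorem theorem3p37:
  fixes Sig :: "'c set" and ar :: "'c \<Rightarrow> nat" and V :: "'v set"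
    and D :: "('c, 'v) fm consequence" and neg :: 'c and p :: 'v and B :: "('c, 'v) fm set"
  assumes "finite Sig" and "neg \<in> Sig" and "ar neg = 1"
    and "countable V" and "infinite V" and "p \<in> V"
    and "B \<noteq> {}" and "B \<subseteq> formulas Sig ar V" and "\<forall>\<psi> \<in> B. vars \<psi> = {p}"
    and "LFI Sig ar V D neg p B"
  shows "(pfECQ (formulas Sig ar V) D \<and> sECQ (formulas Sig ar V) D) \<and>
    (finite B \<and>
     (\<exists>con \<in> Sig. ar con = 2 \<and>
        (\<forall>\<alpha> \<in> formulas Sig ar V. \<forall>\<beta> \<in> formulas Sig ar V.
           ({Op con [\<alpha>, \<beta>]}, \<alpha>) \<in> D \<and> ({Op con [\<alpha>, \<beta>]}, \<beta>) \<in> D))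
     \<longrightarrow> spECQ (formulas Sig ar V) D \<and> gECQ (formulas Sig ar V) D)"
proof -
  let ?L = "formulas Sig ar V"
  have std: "standard_logic Sig ar V D" using assms(10) by (simp add: LFI_def)
  have "V \<noteq> {}" using assms(6) by blast
  note explosive = exists_large_explosive_set[where ar = ar, OF assms(2,3) this assms(8-10)]
  \<comment> \<open>Some formula is strictly larger than \<alpha>, hence distinct from it.\<close>
  have not_singleton: "?L \<noteq> {\<alpha>}" for \<alpha>
    using exists_large_formula[where ar = ar, OF assms(2,3) \<open>V \<noteq> {}\<close>, of "size \<alpha>"] by auto
  have pf: "pfECQ ?L D"
    unfolding pfECQ_def
  proof (intro allI impI)
    fix \<Gamma> assume \<Gamma>: "\<Gamma> \<subset> ?L"
    then obtain \<gamma> where \<gamma>: "\<gamma> \<in> ?L" "\<gamma> \<notin> \<Gamma>" by blast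
    \<comment> \<open>The bound is the size of \<gamma>, so \<gamma> cannot belong to
      \<open>E\<close> and stays a witness that the union is proper.\<close>
    obtain E where E: "E \<subseteq> ?L" "Cn D E = ?L" "\<forall>\<chi> \<in> E. size \<gamma> < size \<chi>"
      using explosive[of "size \<gamma>"] by blast
    have sub: "\<Gamma> \<union> E \<subseteq> ?L" using \<Gamma> E(1) by blast
    moreover have "\<gamma> \<notin> \<Gamma> \<union> E" using \<gamma>(2) E(3) by blast
    moreover have "Cn D (\<Gamma> \<union> E) = ?L"
      using Cn_refl[OF std sub] by (intro explosive_if_proves_explosive[OF std sub _ E(2)]) blast
    ultimately show "\<exists>\<Delta> \<subset> ?L. \<Gamma> \<subseteq> \<Delta> \<and> Cn D \<Delta> = ?L"
      using \<gamma>(1) by (intro exI[where x = "\<Gamma> \<union> E"]) blast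
  qed
  have sp: "spECQ ?L D"
    if fin: "finite B" and con: "con \<in> Sig" "ar con = 2"
      and elim: "\<forall>\<alpha> \<in> ?L. \<forall>\<beta> \<in> ?L. ({Op con [\<alpha>, \<beta>]}, \<alpha>) \<in> D \<and> ({Op con [\<alpha>, \<beta>]}, \<beta>) \<in> D"
    for con
    unfolding spECQ_def
  proof (intro allI impI)
    fix \<Gamma> assume \<Gamma>: "\<Gamma> \<subset> ?L"
    then obtain \<gamma> where \<gamma>: "\<gamma> \<in> ?L" "\<gamma> \<notin> \<Gamma>" by blast
    obtain E where E: "E \<subseteq> ?L" "E \<noteq> {}" "finite E" "Cn D E = ?L" "\<forall>\<chi> \<in> E. size \<gamma> < size \<chi>"
      using explosive[of "size \<gamma>"] fin by blast
    obtain \<beta> where \<beta>: "\<beta> \<in> ?L" "E \<subseteq> Cn D {\<beta>}" "\<forall>\<chi> \<in> E. size \<chi> \<le> size \<beta>"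
      using exists_finite_conjunction[OF std con elim E(3,2,1)] by blast
    have sub: "\<Gamma> \<union> {\<beta>} \<subseteq> ?L" using \<Gamma> \<beta>(1) by blast
    \<comment> \<open>Any \<chi> in the nonempty set \<open>E\<close> gives
      \<open>size \<gamma> < size \<chi> \<le> size \<beta>\<close>.\<close>
    moreover have "\<gamma> \<noteq> \<beta>" using E(2,5) \<beta>(3) by fastforce
    \<comment> \<open>By monotonicity \<Gamma> together with \<beta> still entails every member of
      the explosive set \<open>E\<close>.\<close>
    moreover have "Cn D (\<Gamma> \<union> {\<beta>}) = ?L"
      using Cn_mono[OF std _ sub, of "{\<beta>}"] \<beta>(2)
      by (intro explosive_if_proves_explosive[OF std sub _ E(4)]) blast
    ultimately show "\<exists>\<alpha> \<in> ?L. \<Gamma> \<union> {\<alpha>} \<subset> ?L \<and> Cn D (\<Gamma> \<union> {\<alpha>}) = ?L"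
      using \<gamma> \<beta>(1) by (intro bexI[where x = \<beta>]) blast+
  qed
  show ?thesis
    using pf pfECQ_imp_sECQ[OF pf not_singleton] sp spECQ_imp_gECQ[OF _ not_singleton] by blast
qed

end
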